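(* Let $(X,\mathcal{I})$ be a matroid on a finite set $X$ and $f:\mathcal{I}\rightarrow\mathbb{R}$ a polymatroid function. Let $g:2^X\rightarrow\mathbb{R}$ be a polymatroid function that agrees with $f$ on $\mathcal{I}$. Then $c(g)=b(f)$ if and only if $$g(X)-g(X\setminus\{a\})\geq(1-b(f))\,g(\{a\})$$ for any $a\in X$, and equality holds for some $a\in X$. Here $b(f)$ is the partial curvature of $f$ and $c(g)$ is the total curvature of $g$.
   Context: A function $h:\mathcal{J}\rightarrow\mathbb{R}$, where $\mathcal{J}$ is the collection of independent sets of a matroid on $X$ (including $\mathcal{J}=2^X$), is a polymatroid function if $h(\emptyset)=0$, $h$ is monotone ($h(A)\leq h(B)$ for all $A\subseteq B$ with $A,B\in\mathcal{J}$), and $h$ is submodular ($h(A\cup\{j\})-h(A)\geq h(B\cup\{j\})-h(B)$ for all $A\subseteq B$ and $j\in X\setminus B$ with $B\cup\{j\}\in\mathcal{J}$). The partial curvature of $f:\mathcal{I}\rightarrow\mathbb{R}$ is $$b(f)=\max_{j,A:\ j\in A\in\mathcal{I},\ f(\{j\})\neq f(\emptyset)}\left\{1-\frac{f(A)-f(A\setminus\{j\})}{f(\{j\})-f(\emptyset)}\right\},$$ and the total curvature of $g:2^X\rightarrow\mathbb{R}$ is $$c(g)=\max_{j\in X,\ g(\{j\})\neq g(\emptyset)}\left\{1-\frac{g(X)-g(X\setminus\{j\})}{g(\{j\})-g(\emptyset)}\right\}.$$ It is assumed that $f(\{j\})\neq 0$ for some $\{j\}\in\mathcal{I}$, so that both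 maxima are over nonempty sets. *)

theory Defs imports Complex_Main begin

locale matroid =
  fixes X :: "'a set" and \<I> :: "'a set set"
  assumes finite_ground: "finite X"
    and indep_subset_ground: "A \<in> \<I> \<Longrightarrow> A \<subseteq> X"
    and indep_empty: "{} \<in> \<I>"
    and indep_hereditary: "B \<in> \<I> \<Longrightarrow> A \<subseteq> B \<Longrightarrow> A \<in> \<I>"
    and indep_augment: "A \<in> \<I> \<Longrightarrow> B \<in> \<I> \<Longrightarrow> card A < card B \<Longrightarrow> \<exists>x\<in>B - A. insert x A \<in> \<I>"

lemma matroid_Pow: "finite X \<Longrightarrow> matroid X (Pow X)"
proof (unfold_locales, goal_cases)
  case (5 A B)
  then have "\<not> B \<subseteq> A"
    by (metis Pow_iff card_mono finite_subset not_le)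
  with 5 show ?case by auto
qed auto

(* A function on the independent sets is represented by a total function on sets;
   its values outside J never enter the conditions. In the submodularity clause,
   B, A and A \<union> {j} lie in J as subsets of B \<union> {j}. *)
definition polymatroid_function :: "'a set \<Rightarrow> 'a set set \<Rightarrow> ('a set \<Rightarrow> real) \<Rightarrow> bool" where
  "polymatroid_function X J h \<longleftrightarrow>
     h {} = 0 \<and>
     (\<forall>A\<in>J. \<forall>B\<in>J. A \<subseteq> B \<longrightarrow> h A \<le> h B) \<and>
     (\<forall>A B j. A \<subseteq> B \<and> j \<in> X - B \<and> B \<union> {j} \<in> J \<longrightarrow>
        h (A \<union> {j}) - h A \<ge> h (B \<union> {j}) - h B)"

(* Max is unspecified on the empty set, so both curvatures are meaningful only
   when some singleton has a value different from that of the empty set. *)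
definition partial_curvature :: "'a set set \<Rightarrow> ('a set \<Rightarrow> real) \<Rightarrow> real" where
  "partial_curvature \<I> f =
     Max {1 - (f A - f (A - {j})) / (f {j} - f {}) | j A.
            j \<in> A \<and> A \<in> \<I> \<and> f {j} \<noteq> f {}}"

definition total_curvature :: "'a set \<Rightarrow> ('a set \<Rightarrow> real) \<Rightarrow> real" where
  "total_curvature X g =
     Max {1 - (g X - g (X - {j})) / (g {j} - g {}) | j.
            j \<in> X \<and> g {j} \<noteq> g {}}"

end

theory Submission imports Defs begin

text \<open>
  By submodularity the marginal value of an element is smallest at the top set, so
  \<open>b(f) \<le> c(g)\<close> holds for every extension \<open>g\<close>. Clearing denominators,
  the inequalities for all \<open>a\<close> say exactly that \<open>c(g) \<le> b(f)\<close>, and a maximiser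
  for \<open>c(g)\<close> attains equality.
\<close>

text \<open>Submodularity for the pair \<open>A - {j}\<close>, \<open>B - {j}\<close>, restated for
  removing \<open>j\<close> because both curvatures are written that way.\<close>

lemma polymatroid_function_marginal_antimono:
  assumes "polymatroid_function X (Pow X) g" "j \<in> A" "A \<subseteq> B" "B \<subseteq> X"
  shows "g B - g (B - {j}) \<le> g A - g (A - {j})"
proof -
  have "A - {j} \<subseteq> B - {j}" "j \<in> X - (B - {j})" "(B - {j}) \<union> {j} \<in> Pow X"
    using assms by auto
  then have "g ((A - {j}) \<union> {j}) - g (A - {j}) \<ge> g ((B - {j}) \<union> {j}) - g (B - {j})"
    using assms(1) unfolding polymatroid_function_def by blast
  moreover have "(A - {j}) \<union> {j} = A" "(B - {j}) \<union> {j} = B"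
    using assms by auto
  ultimately show ?thesis by simp
qed

lemma polymatroid_function_nonneg:
  assumes "polymatroid_function X J h" "{} \<in> J" "A \<in> J"
  shows "0 \<le> h A"
  using assms unfolding polymatroid_function_def by (metis empty_subsetI)

text \<open>The threshold \<open>c\<close> is left free because two values matter: the partial
  curvature in the theorem, and the total curvature itself when the two curvatures are
  compared.\<close>

lemma total_curvature_le_iff:
  assumes "finite X" and g: "polymatroid_function X (Pow X) g"
    and "\<exists>j\<in>X. g {j} \<noteq> 0"
  shows "total_curvature X g \<le> c \<longleftrightarrow>
    (\<forall>a\<in>X. g X - g (X - {a}) \<ge> (1 - c) * g {a})"
proof -
  have g0: "g {} = 0" using g by (simp add: polymatroid_function_def)
  let ?S = "{1 - (g X - g (X - {j})) / (g {j} - g {}) | j. j \<in> X \<and> g {j} \<noteq> g {}}"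
  have "finite ?S" "?S \<noteq> {}"
    using assms(1,3) g0 by auto
  then have "total_curvature X g \<le> c \<longleftrightarrow>
      (\<forall>a\<in>X. g {a} \<noteq> 0 \<longrightarrow> 1 - (g X - g (X - {a})) / g {a} \<le> c)"
    unfolding total_curvature_def by (auto simp: g0)
  also have "\<dots> \<longleftrightarrow> (\<forall>a\<in>X. g X - g (X - {a}) \<ge> (1 - c) * g {a})"
  proof (rule ball_cong[OF refl])
    fix a assume a: "a \<in> X"
    have "0 \<le> g {a}" using polymatroid_function_nonneg[OF g] a by simp
    moreover have "g (X - {a}) \<le> g X"
      using g unfolding polymatroid_function_def by auto
    \<comment> \<open>If \<open>g {a} = 0\<close>, the left side is vacuous and the right side is
      monotonicity; otherwise \<open>g {a} > 0\<close>, and multiplying by it keeps the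
      direction.\<close>
    ultimately show "(g {a} \<noteq> 0 \<longrightarrow> 1 - (g X - g (X - {a})) / g {a} \<le> c) \<longleftrightarrow>
        g X - g (X - {a}) \<ge> (1 - c) * g {a}"
      by (cases "g {a} = 0") (auto simp: field_simps)
  qed
  finally show ?thesis .
qed

lemma total_curvature_attained:
  assumes "finite X" "g {} = 0" "\<exists>j\<in>X. g {j} \<noteq> 0"
  shows "\<exists>a\<in>X. g X - g (X - {a}) = (1 - total_curvature X g) * g {a}"
proof -
  let ?S = "{1 - (g X - g (X - {j})) / (g {j} - g {}) | j. j \<in> X \<and> g {j} \<noteq> g {}}"
  have "finite ?S" "?S \<noteq> {}" using assms by auto
  then have "total_curvature X g \<in> ?S"
    unfolding total_curvature_def by (rule Max_in)
  then obtain a where "a \<in> X" "g {a} \<noteq> 0"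
    "total_curvature X g = 1 - (g X - g (X - {a})) / g {a}"
    using assms(2) by auto
  then show ?thesis by (intro bexI[of _ a]) simp_all
qed

text \<open>Each ratio for \<open>f\<close> at \<open>(j, A)\<close> is also a ratio for
  \<open>g\<close>, and enlarging \<open>A\<close> to \<open>X\<close> can only lower the marginal
  value of \<open>j\<close>, hence raise the ratio.\<close>

lemma partial_curvature_le_total_curvature:
  assumes "matroid X \<I>" and g: "polymatroid_function X (Pow X) g"
    and f0: "f {} = 0" and gf: "\<forall>A\<in>\<I>. g A = f A"
    and nz: "\<exists>j. {j} \<in> \<I> \<and> f {j} \<noteq> 0"
  shows "partial_curvature \<I> f \<le> total_curvature X g"
proof -
  interpret matroid X \<I> by fact
  have g0: "g {} = 0" using g by (simp add: polymatroid_function_def)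
  let ?h = "\<lambda>(j, A). 1 - (f A - f (A - {j})) / (f {j} - f {})"
  let ?S = "{1 - (f A - f (A - {j})) / (f {j} - f {}) | j A.
               j \<in> A \<and> A \<in> \<I> \<and> f {j} \<noteq> f {}}"
  have "?S \<subseteq> ?h ` (X \<times> Pow X)"
    using indep_subset_ground by fastforce
  then have "finite ?S"
    by (rule finite_subset) (simp add: finite_ground)
  moreover have "?S \<noteq> {}" using nz f0 by auto
  moreover have "x \<le> total_curvature X g" if "x \<in> ?S" for x
  proof -
    from that obtain j A where j: "j \<in> A" "A \<in> \<I>" "f {j} \<noteq> 0"
      and x: "x = 1 - (f A - f (A - {j})) / f {j}"
      using f0 by auto
    \<comment> \<open>Heredity puts every set in the ratio inside \<open>\<I>\<close>, where
      \<open>f\<close> and \<open>g\<close> agree.\<close>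
    have "{j} \<in> \<I>" "A - {j} \<in> \<I>" using j indep_hereditary by auto
    with j gf have eq: "f A = g A" "f (A - {j}) = g (A - {j})" "f {j} = g {j}" by auto
    have AX: "A \<subseteq> X" using j indep_subset_ground by blast
    then have jX: "j \<in> X" using j by blast
    have gj: "0 < g {j}"
      using polymatroid_function_nonneg[OF g, of "{j}"] jX j eq by simp
    \<comment> \<open>Taking the total curvature as its own bound makes the left side of the
      equivalence trivially true.\<close>
    have "(1 - total_curvature X g) * g {j} \<le> g X - g (X - {j})"
      using total_curvature_le_iff[OF finite_ground g, of "total_curvature X g"] jX gj by fastforce
    also have "\<dots> \<le> g A - g (A - {j})"
      using polymatroid_function_marginal_antimono[OF g j(1) AX] by simp
    finally show ?thesis
      using gj unfolding x eq by (simp add: field_simps)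
  qed
  ultimately show ?thesis
    unfolding partial_curvature_def by (intro Max.boundedI)
qed

theorem theorem7:
  fixes X :: "'a set" and \<I> :: "'a set set" and f g :: "'a set \<Rightarrow> real"
  assumes "matroid X \<I>"
    and "polymatroid_function X \<I> f"
    and "polymatroid_function X (Pow X) g"
    and "\<forall>A\<in>\<I>. g A = f A"
    and "\<exists>j. {j} \<in> \<I> \<and> f {j} \<noteq> 0"
  shows "total_curvature X g = partial_curvature \<I> f \<longleftrightarrow>
    (\<forall>a\<in>X. g X - g (X - {a}) \<ge> (1 - partial_curvature \<I> f) * g {a}) \<and>
    (\<exists>a\<in>X. g X - g (X - {a}) = (1 - partial_curvature \<I> f) * g {a})"
proof -
  interpret matroid X \<I> by fact
  have f0: "f {} = 0" and g0: "g {} = 0"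
    using assms(2,3) by (simp_all add: polymatroid_function_def)
  have nz: "\<exists>j\<in>X. g {j} \<noteq> 0"
    using assms(4,5) indep_subset_ground by (metis insert_subset)
  have le: "partial_curvature \<I> f \<le> total_curvature X g"
    using partial_curvature_le_total_curvature assms(1,3-5) f0 by blast
  note iff = total_curvature_le_iff[OF finite_ground assms(3) nz, of "partial_curvature \<I> f"]
  show ?thesis
    \<comment> \<open>By \<open>le\<close>, equality of the curvatures amounts to the bound in
      \<open>iff\<close>; once they are equal, a maximiser for \<open>total_curvature\<close> is the
      witness for the existential.\<close>
    using le iff total_curvature_attained[OF finite_ground g0 nz] by (metis order_antisym order_refl)
qed

end
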